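(* Let $\kappa$ be an infinite regular cardinal with $\kappa\le\mathfrak d$, let $X\subseteq[\omega]^\omega$ be a $\kappa$-fin-unbounded set, let $k$ be a natural number, and let $Y$ be a set of reals satisfying $\mathsf{S}_1(\Gamma_{\mathrm{Bor}},\Gamma_{\mathrm{Bor}})$. Then: (1) the space $(X\cup\mathrm{Fin})_{\mathrm M}^k\times Y$ satisfies $\mathsf{S}_1(\Gamma,\Omega)$; (2) the space $(X\cup\mathrm{Fin})^k\times Y$ (with the topology inherited from $\mathcal P(\omega)^k\times Y$) satisfies $\mathsf{S}_1(\Gamma,\Omega)$.
   Context: All spaces are infinite Tychonoff spaces; a set of reals is a space homeomorphic to a subspace of the Cantor space $\mathcal P(\omega)$. $[\omega]^\omega$ and $\mathrm{Fin}$ denote the infinite and the finite subsets of $\omega$; each $a\in[\omega]^\omega$ is identified with its increasing enumeration, an element of $\omega^\omega$. For $a,b\in[\omega]^\omega$, $a\le^* b$ means $a(n)\le b(n)$ for all but finitely many $n$; $\mathfrak d$ is the least size of a set $D\subseteq[\omega]^\omega$ such that every $a\in[\omega]^\omega$ is $\le^*$ some member of $D$. A set $x\subseteq\omega$ omits an interval of $a\in[\omega]^\omega$ if $x\cap[a(n),a(n+1))=\emptyset$ for some $n$. For an infinite cardinal $\kappa$, a set $X\subseteq[\omega]^\omega$ is $\kappa$-fin-unbounded if $|X|\ge\kappa$ and for every $d\in[\omega]^\omega$ there is $S\subseteq X$ with $|S|<\kappa$ such that for every finite $F\subseteq X\setminus S$ the set $\bigcup F$ omits infinitely many intervals of $d$.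 The Michael topology on $\mathcal P(\omega)$: points of $\mathrm{Fin}$ have the same neighbourhoods as in the standard topology of $\mathcal P(\omega)$, and all points of $[\omega]^\omega$ are isolated; $Z_{\mathrm M}$ denotes $Z\subseteq\mathcal P(\omega)$ with the subspace Michael topology. A cover $\mathcal U$ of a space $Z$ is an $\omega$-cover if $Z\notin\mathcal U$ and every finite subset of $Z$ is contained in a member of $\mathcal U$; it is a $\gamma$-cover if it is infinite and each point of $Z$ lies outside only finitely many members. $\Gamma,\Omega$ denote open $\gamma$-covers and open $\omega$-covers; $\Gamma_{\mathrm{Bor}}$ denotes countable $\gamma$-covers by Borel sets. A space $Z$ satisfies $\mathsf S_1(\mathcal A,\mathcal B)$ if for every sequence $\mathcal U_0,\mathcal U_1,\dots$ of covers of $Z$ from class $\mathcal A$ there are $U_n\in\mathcal U_n$ with $\{U_n:n\in\omega\}$ a cover of $Z$ from class $\mathcal B$. *)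

theory Defs
  imports "HOL-Analysis.Analysis"
begin

unbundle cardinal_syntax

abbreviation Fin :: "nat set set"
  where "Fin \<equiv> {x. finite x}"

abbreviation Infs :: "nat set set"
  where "Infs \<equiv> {x. infinite x}"

definition cantor_space :: "nat set topology"
  where "cantor_space =
    pullback_topology UNIV (\<lambda>x n. n \<in> x) (product_topology (\<lambda>_. discrete_topology (UNIV :: bool set)) UNIV)"

text \<open>The condition restricts only the finite points of \<open>U\<close>: these keep their Cantor
  neighbourhoods, while every singleton of an infinite set becomes open.\<close>

definition michael_space :: "nat set topology"
  where "michael_space =
    topology (\<lambda>U. \<forall>x\<in>U \<inter> Fin. \<exists>V. openin cantor_space V \<and> x \<in> V \<and> V \<subseteq> U)"

definition set_of_reals :: "'a topology \<Rightarrow> bool"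
  where "set_of_reals Y \<longleftrightarrow> (\<exists>S. Y homeomorphic_space subtopology cantor_space S)"

lemma topspace_cantor_space [simp]: "topspace cantor_space = UNIV"
  by (simp add: cantor_space_def topspace_pullback_topology)

lemma istopology_michael:
  "istopology (\<lambda>U. \<forall>x\<in>U \<inter> Fin. \<exists>V. openin cantor_space V \<and> x \<in> V \<and> V \<subseteq> U)"
  unfolding istopology_def
proof (intro conjI allI impI ballI)
  fix S T x
  assume S: "\<forall>x\<in>S \<inter> Fin. \<exists>V. openin cantor_space V \<and> x \<in> V \<and> V \<subseteq> S"
    and T: "\<forall>x\<in>T \<inter> Fin. \<exists>V. openin cantor_space V \<and> x \<in> V \<and> V \<subseteq> T"
    and x: "x \<in> S \<inter> T \<inter> Fin"
  obtain V where V: "openin cantor_space V" "x \<in> V" "V \<subseteq> S"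
    using S x by blast
  obtain W where W: "openin cantor_space W" "x \<in> W" "W \<subseteq> T"
    using T x by blast
  have "openin cantor_space (V \<inter> W) \<and> x \<in> V \<inter> W \<and> V \<inter> W \<subseteq> S \<inter> T"
    using V W by blast
  then show "\<exists>V. openin cantor_space V \<and> x \<in> V \<and> V \<subseteq> S \<inter> T" ..
next
  fix \<K> :: "nat set set set" and x
  assume K: "\<forall>K\<in>\<K>. \<forall>x\<in>K \<inter> Fin. \<exists>V. openin cantor_space V \<and> x \<in> V \<and> V \<subseteq> K"
    and x: "x \<in> \<Union>\<K> \<inter> Fin"
  then obtain K where "K \<in> \<K>" "x \<in> K \<inter> Fin"
    by blast
  with K obtain V where "openin cantor_space V" "x \<in> V" "V \<subseteq> K"
    by blast
  with \<open>K \<in> \<K>\<close> show "\<exists>V. openin cantor_space V \<and> x \<in> V \<and> V \<subseteq> \<Union>\<K>"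
    by blast
qed

lemma openin_michael_space:
  "openin michael_space U \<longleftrightarrow> (\<forall>x\<in>U \<inter> Fin. \<exists>V. openin cantor_space V \<and> x \<in> V \<and> V \<subseteq> U)"
  unfolding michael_space_def by (simp only: topology_inverse'[OF istopology_michael])

lemma topspace_michael_space [simp]: "topspace michael_space = UNIV"
proof -
  have "openin michael_space UNIV"
    unfolding openin_michael_space using openin_topspace[of cantor_space] by auto
  then show ?thesis
    using openin_subset by blast
qed

definition le_star :: "nat set \<Rightarrow> nat set \<Rightarrow> bool"
  where "le_star a b \<longleftrightarrow> (\<forall>\<^sub>\<infinity>n. enumerate a n \<le> enumerate b n)"

definition dominating :: "nat set set \<Rightarrow> bool"
  where "dominating D \<longleftrightarrow> D \<subseteq> Infs \<and> (\<forall>a\<in>Infs. \<exists>b\<in>D. le_star a b)"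

definition dominating_number :: "nat set rel"
  where "dominating_number =
    |SOME D. dominating D \<and> (\<forall>D'. dominating D' \<longrightarrow> |D| \<le>o |D'| )|"

lemma dominating_number_is_least:
  "\<exists>D. dominating D \<and> dominating_number = |D| \<and> (\<forall>D'. dominating D' \<longrightarrow> |D| \<le>o |D'| )"
proof -
  have "dominating Infs"
    by (auto simp: dominating_def le_star_def)
  then have "\<exists>r\<in>card_of ` Collect dominating. \<forall>r'\<in>card_of ` Collect dominating. r \<le>o r'"
    by (intro exists_minim_Card_order) (auto simp: card_of_Card_order)
  then have "\<exists>D. dominating D \<and> (\<forall>D'. dominating D' \<longrightarrow> |D| \<le>o |D'| )"
    by auto
  from someI_ex[OF this] show ?thesis
    unfolding dominating_number_def by blast
qed

text \<open>Indices of omitted intervals; for infinite \<open>a\<close> the intervals are nonempty and pairwise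
  disjoint, so counting indices is the same as counting intervals.\<close>

definition omitted_intervals :: "nat set \<Rightarrow> nat set \<Rightarrow> nat set"
  where "omitted_intervals x a = {n. x \<inter> {enumerate a n..<enumerate a (Suc n)} = {}}"

definition fin_unbounded :: "'c rel \<Rightarrow> nat set set \<Rightarrow> bool"
  where "fin_unbounded \<kappa> X \<longleftrightarrow> X \<subseteq> Infs \<and> \<kappa> \<le>o |X| \<and>
    (\<forall>d\<in>Infs. \<exists>S\<subseteq>X. |S| <o \<kappa> \<and>
      (\<forall>F. finite F \<and> F \<subseteq> X - S \<longrightarrow> infinite (omitted_intervals (\<Union>F) d)))"

definition cover_of :: "'a topology \<Rightarrow> 'a set set \<Rightarrow> bool"
  where "cover_of Z \<U> \<longleftrightarrow> \<Union>\<U> = topspace Z"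

definition omega_cover :: "'a topology \<Rightarrow> 'a set set \<Rightarrow> bool"
  where "omega_cover Z \<U> \<longleftrightarrow> cover_of Z \<U> \<and> topspace Z \<notin> \<U> \<and>
    (\<forall>F. finite F \<and> F \<subseteq> topspace Z \<longrightarrow> (\<exists>U\<in>\<U>. F \<subseteq> U))"

definition gamma_cover :: "'a topology \<Rightarrow> 'a set set \<Rightarrow> bool"
  where "gamma_cover Z \<U> \<longleftrightarrow> cover_of Z \<U> \<and> infinite \<U> \<and>
    (\<forall>z\<in>topspace Z. finite {U\<in>\<U>. z \<notin> U})"

definition borel_sets_of :: "'a topology \<Rightarrow> 'a set set"
  where "borel_sets_of Z = sigma_sets (topspace Z) {U. openin Z U}"

definition Open_Omega :: "'a topology \<Rightarrow> 'a set set set"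
  where "Open_Omega Z = {\<U>. omega_cover Z \<U> \<and> (\<forall>U\<in>\<U>. openin Z U)}"

definition Open_Gamma :: "'a topology \<Rightarrow> 'a set set set"
  where "Open_Gamma Z = {\<U>. gamma_cover Z \<U> \<and> (\<forall>U\<in>\<U>. openin Z U)}"

definition Borel_Gamma :: "'a topology \<Rightarrow> 'a set set set"
  where "Borel_Gamma Z = {\<U>. gamma_cover Z \<U> \<and> countable \<U> \<and> \<U> \<subseteq> borel_sets_of Z}"

definition S1 ::
  "('a topology \<Rightarrow> 'a set set set) \<Rightarrow> ('a topology \<Rightarrow> 'a set set set) \<Rightarrow> 'a topology \<Rightarrow> bool"
  where "S1 \<A> \<B> Z \<longleftrightarrow>
    (\<forall>\<U> :: nat \<Rightarrow> 'a set set. (\<forall>n. \<U> n \<in> \<A> Z) \<longrightarrow>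
      (\<exists>U. (\<forall>n. U n \<in> \<U> n) \<and> range U \<in> \<B> Z))"

end

theory Submission
  imports Defs
begin

text \<open>
  The hypothesis on \<open>Y\<close> makes countably many Borel choices uniform in \<open>y\<close>, up to finitely many
  exceptions. Applied to a sequence of \<open>\<gamma>\<close>-covers \<open>{U n m | m}\<close> and the finite sets \<open>Pow {..<n}\<close>
  of points of \<open>Fin\<close>, it gives a function \<open>\<phi>\<close> such that whenever \<open>g\<close> is infinitely often above
  \<open>\<phi>\<close>, the sets \<open>U n (g n)\<close> capture all points whose coordinates omit suitable intervals; as \<open>X\<close>
  is \<open>\<kappa>\<close>-fin-unbounded, these include all finite sets of points with coordinates off some
  \<open>S \<subseteq> X\<close> of size \<open>< \<kappa>\<close>. Since \<open>\<kappa> \<le> \<dd>\<close> one \<open>g\<close> serves fewer than \<open>\<kappa>\<close> many sequences of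
  covers, and since \<open>\<kappa>\<close> is regular so does one \<open>S\<close>. Points with a coordinate in \<open>S\<close> are points of
  one of fewer than \<open>\<kappa>\<close> many sections with one coordinate less, so an induction on the number of
  distinct coordinates finishes the proof.
\<close>

section \<open>Consequences of the combinatorial hypotheses\<close>

lemma enumerate_range_strict_mono:
  fixes d :: "nat \<Rightarrow> nat"
  assumes "strict_mono d"
  shows "enumerate (range d) = d"
proof
  fix n
  show "enumerate (range d) n = d n"
  proof (induction n)
    case 0
    have "(LEAST s. s \<in> range d) = d 0"
      using assms by (intro Least_equality) (auto simp: strict_mono_less_eq)
    then show ?case
      by (simp add: enumerate_0)
  next
    case (Suc n)
    have inf: "infinite (range d)"
      using assms by (simp add: range_inj_infinite strict_mono_imp_inj_on)
    have "(LEAST s. s \<in> range d \<and> d n < s) = d (Suc n)"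
      using assms by (intro Least_equality) (auto simp: strict_mono_less strict_mono_less_eq Suc_leI)
    then show ?case
      using enumerate_Suc''[OF inf, of n] Suc by simp
  qed
qed

text \<open>Each \<open>\<phi> t\<close> lies below a strictly increasing \<open>e t\<close>, which
  is the enumeration of its own range. These ranges are too few to dominate, and the enumeration of
  a set that none of them dominates serves as \<open>g\<close>.\<close>

lemma small_family_not_dominating:
  fixes \<phi> :: "'a \<Rightarrow> nat \<Rightarrow> nat"
  assumes "|T| <o dominating_number"
  obtains g where "\<And>t. t \<in> T \<Longrightarrow> infinite {n. \<phi> t n \<le> g n}"
proof -
  define e where "e t n = (\<Sum>i\<le>n. Suc (\<phi> t i))" for t n
  have sm: "strict_mono (e t)" for t
    by (simp add: strict_mono_Suc_iff e_def)
  have le: "\<phi> t n \<le> e t n" for t n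
    using member_le_sum[of n "{..n}" "\<lambda>i. Suc (\<phi> t i)"] by (simp add: e_def)
  define D' where "D' = (\<lambda>t. range (e t)) ` T"
  have inf: "D' \<subseteq> Infs"
    using sm by (auto simp: D'_def range_inj_infinite strict_mono_imp_inj_on)
  have "\<not> dominating D'"
  proof
    assume "dominating D'"
    then have "dominating_number \<le>o |D'|"
      using dominating_number_is_least by metis
    also have "|D'| \<le>o |T|"
      unfolding D'_def by (rule card_of_image)
    finally show False
      using assms not_ordLess_ordLeq by blast
  qed
  then obtain a where a: "a \<in> Infs" "\<And>b. b \<in> D' \<Longrightarrow> \<not> le_star a b"
    using inf by (auto simp: dominating_def)
  show thesis
  proof
    fix t assume "t \<in> T"
    then have "\<not> le_star a (range (e t))"
      using a by (simp add: D'_def)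
    then have "\<exists>\<^sub>\<infinity>n. e t n < enumerate a n"
      by (simp add: le_star_def enumerate_range_strict_mono[OF sm] not_le)
    then have "\<exists>\<^sub>\<infinity>n. \<phi> t n \<le> enumerate a n"
      by (rule INFM_mono) (meson le le_trans less_imp_le)
    then show "infinite {n. \<phi> t n \<le> enumerate a n}"
      by (simp add: INFM_iff_infinite)
  qed
qed

section \<open>Selection from Borel \<gamma>-covers, in index form\<close>

lemma borel_sets_of_openin: "openin Y U \<Longrightarrow> U \<in> borel_sets_of Y"
  by (auto simp: borel_sets_of_def intro: sigma_sets.Basic)

lemma sigma_algebra_borel_sets_of: "sigma_algebra (topspace Y) (borel_sets_of Y)"
  unfolding borel_sets_of_def by (rule sigma_algebra_sigma_sets) (auto dest: openin_subset)

text \<open>\<open>S1 Borel_Gamma Borel_Gamma\<close> selects from sets of sets and so may repeat one member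
  infinitely often; making the covers finer and finer and reading the selection only at its
  first occurrences turns it into an eventual statement about indices.\<close>

lemma S1_Borel_Gamma_eventually:
  fixes B :: "nat \<Rightarrow> nat \<Rightarrow> 'b set"
  assumes S1: "S1 Borel_Gamma Borel_Gamma Y"
    and B: "\<And>n m. B n m \<in> borel_sets_of Y"
    and ev: "\<And>n y. y \<in> topspace Y \<Longrightarrow> \<forall>\<^sub>F m in sequentially. y \<in> B n m"
  shows "\<exists>f. \<forall>y\<in>topspace Y. \<forall>\<^sub>F n in sequentially. \<forall>m\<ge>f n. y \<in> B n m"
proof -
  interpret sigma_algebra "topspace Y" "borel_sets_of Y"
    by (rule sigma_algebra_borel_sets_of)
  \<comment> \<open>Intersecting tails makes each row increase with \<open>m\<close>, so that one
    good index yields all later ones.\<close>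
  define C where "C n m = (\<Inter>m'\<in>{m..}. B n m')" for n m
  have C_borel: "C n m \<in> borel_sets_of Y" for n m
    unfolding C_def by (rule countable_INT') (use B in auto)
  have C_mono: "C n m \<subseteq> C n m'" if "m \<le> m'" for n m m'
    using that by (auto simp: C_def)
  have C_ex: "\<exists>m. y \<in> C n m" if "y \<in> topspace Y" for n y
    using ev[OF that, of n] by (auto simp: C_def eventually_sequentially)
  show ?thesis
  proof (cases "\<forall>n. \<exists>m. C n m = topspace Y")
    case True
    then obtain f where f: "\<And>n. C n (f n) = topspace Y"
      by metis
    show ?thesis
    proof (intro exI[of _ f] ballI)
      fix y assume "y \<in> topspace Y"
      then have "y \<in> C n (f n)" for n
        by (simp add: f)
      then show "\<forall>\<^sub>F n in sequentially. \<forall>m\<ge>f n. y \<in> B n m"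
        by (auto simp: C_def)
    qed
  next
    case False
    then obtain n0 where n0: "\<And>m. C n0 m \<noteq> topspace Y"
      by blast
    \<comment> \<open>Row \<open>n0\<close> never reaches the whole space, so including it keeps
      every \<open>D n m\<close> proper. The other rows are included so that a set chosen from a
      later row also serves row \<open>n\<close>.\<close>
    define D where "D n m = (\<Inter>i\<in>{..n0 + n}. C i m)" for n m
    have D_borel: "D n m \<in> borel_sets_of Y" for n m
      unfolding D_def by (rule countable_INT') (use C_borel in auto)
    have D_mono: "D n m \<subseteq> D n m'" if "m \<le> m'" for n m m'
      using C_mono[OF that] by (fastforce simp: D_def)
    have D_sub: "D n m \<subseteq> topspace Y" for n m
      using D_borel space_closed by blast
    have D_ne: "D n m \<noteq> topspace Y" for n m
    proof
      assume "D n m = topspace Y"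
      moreover have "D n m \<subseteq> C n0 m"
        unfolding D_def by (rule INT_lower) simp
      moreover have "C n0 m \<subseteq> topspace Y"
        using C_borel space_closed by blast
      ultimately show False
        using n0 by blast
    qed
    have D_ex: "\<exists>m. y \<in> D n m" if y: "y \<in> topspace Y" for n y
    proof -
      obtain r where r: "\<And>i. y \<in> C i (r i)"
        using C_ex[OF y] by metis
      have "y \<in> C i (Max (r ` {..n0 + n}))" if "i \<le> n0 + n" for i
      proof -
        have "r i \<le> Max (r ` {..n0 + n})"
          using that by (intro Max_ge) auto
        from C_mono[OF this] r show ?thesis
          by blast
      qed
      then show ?thesis
        by (auto simp: D_def)
    qed
    have D_bad: "finite {U \<in> range (D n). y \<notin> U}" if y: "y \<in> topspace Y" for n y
    proof -
      obtain m where m: "y \<in> D n m"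
        using D_ex[OF y] by blast
      have "{U \<in> range (D n). y \<notin> U} \<subseteq> D n ` {..<m}"
      proof
        fix U assume "U \<in> {U \<in> range (D n). y \<notin> U}"
        then obtain j where j: "U = D n j" "y \<notin> D n j"
          by blast
        then have "j < m"
          using D_mono[of m j n] m by (meson not_le subsetD)
        then show "U \<in> D n ` {..<m}"
          using j by blast
      qed
      then show ?thesis
        using finite_surj by blast
    qed
    \<comment> \<open>A finite nonempty chain contains its union, which here is the whole space,
      against \<open>D_ne\<close>.\<close>
    have D_inf: "infinite (range (D n))" for n
    proof
      assume fin: "finite (range (D n))"
      have chain: "subset.chain UNIV (range (D n))"
        unfolding subset_chain_def
      proof (intro conjI ballI)
        fix P Q assume "P \<in> range (D n)" "Q \<in> range (D n)"
        then obtain p q where "P = D n p" "Q = D n q"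
          by blast
        then show "P \<subseteq> Q \<or> Q \<subseteq> P"
          using D_mono linear[of p q] by blast
      qed simp
      have "\<Union>(range (D n)) \<in> range (D n)"
        using Union_in_chain[OF fin _ chain] by blast
      moreover have "\<Union>(range (D n)) = topspace Y"
        using D_ex D_sub by fastforce
      ultimately show False
        using D_ne by (metis rangeE)
    qed
    have "range (D n) \<in> Borel_Gamma Y" for n
    proof -
      have "\<Union>(range (D n)) = topspace Y"
        using D_ex D_sub by fastforce
      then show ?thesis
        using D_inf[of n] D_bad[of _ n] D_borel
        by (auto simp: Borel_Gamma_def gamma_cover_def cover_of_def)
    qed
    then obtain U where U: "\<forall>n. U n \<in> range (D n)" "range U \<in> Borel_Gamma Y"
      using S1[unfolded S1_def, rule_format, of "\<lambda>n. range (D n)"] by blast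
    have "\<forall>n. \<exists>m. U n = D n m"
      using U(1) by blast
    then obtain h where h: "\<And>n. U n = D n (h n)"
      by metis
    define N where "N = {n. U n \<notin> U ` {..<n}}"
    have injN: "inj_on U N"
    proof (rule linorder_inj_onI')
      fix i j assume "i \<in> N" "j \<in> N" "i < j"
      then show "U i \<noteq> U j"
        unfolding N_def by (metis (mono_tags, lifting) image_eqI lessThan_iff mem_Collect_eq)
    qed
    \<comment> \<open>Every value of \<open>U\<close> has a least index, so an infinite range forces
      \<open>N\<close> to be infinite.\<close>
    have "range U \<subseteq> U ` N"
    proof clarify
      fix n
      define j where "j = (LEAST j. U j = U n)"
      have "U j = U n"
        unfolding j_def by (rule LeastI) (rule refl)
      moreover have "U i \<noteq> U n" if "i < j" for i
        using not_less_Least that unfolding j_def by blast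
      ultimately have "j \<in> N"
        by (force simp: N_def)
      then show "U n \<in> U ` N"
        using \<open>U j = U n\<close> by (metis imageI)
    qed
    moreover have "infinite (range U)"
      using U(2) by (simp add: Borel_Gamma_def gamma_cover_def)
    ultimately have infN: "infinite N"
      using finite_subset by blast
    \<comment> \<open>The value for row \<open>n\<close> is read off at some row
      \<open>r n \<ge> n\<close>: membership in \<open>D (r n) m\<close> implies membership in
      \<open>C n m\<close>.\<close>
    then have "\<exists>r\<ge>n. r \<in> N" for n
      by (simp add: infinite_nat_iff_unbounded_le)
    then obtain r where r: "\<And>n. r n \<ge> n" "\<And>n. r n \<in> N"
      by metis
    show ?thesis
    proof (intro exI[of _ "\<lambda>n. h (r n)"] ballI)
      fix y assume y: "y \<in> topspace Y"
      have "finite {V \<in> range U. y \<notin> V}"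
        using U(2) y by (simp add: Borel_Gamma_def gamma_cover_def)
      then have "finite (U ` {n \<in> N. y \<notin> U n})"
        by (rule rev_finite_subset) blast
      then have "finite {n \<in> N. y \<notin> U n}"
        using injN by (metis (no_types, lifting) finite_imageD inj_on_subset mem_Collect_eq subsetI)
      then obtain k where k: "\<And>n. n \<in> N \<Longrightarrow> n > k \<Longrightarrow> y \<in> U n"
        by (metis (mono_tags, lifting) finite_nat_set_iff_bounded_le leD mem_Collect_eq)
      have "\<forall>m\<ge>h (r n). y \<in> B n m" if "n > k" for n
      proof -
        have "y \<in> D (r n) (h (r n))"
          using k[OF r(2)[of n]] r(1)[of n] that h by force
        moreover have "n \<le> n0 + r n"
          using r(1)[of n] by simp
        ultimately have "y \<in> C n (h (r n))"
          by (auto simp: D_def)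
        then show ?thesis
          by (auto simp: C_def)
      qed
      then show "\<forall>\<^sub>F n in sequentially. \<forall>m\<ge>h (r n). y \<in> B n m"
        unfolding eventually_sequentially by (intro exI[of _ "Suc k"]) (simp add: Suc_le_eq)
    qed
  qed
qed

section \<open>Covers as arrays indexed by finite sets of coordinates\<close>

text \<open>A set \<open>U\<close> open in \<open>Z\<^sup>k \<times> Y\<close> is represented by the map sending a finite \<open>A \<subseteq> Z\<close> to
  the set of all \<open>y\<close> with \<open>A\<^sup>k \<times> {y} \<subseteq> U\<close>. Openness in the Michael topology becomes the property
  below, which, unlike \<open>U\<close> itself, is insensitive to the order of coordinates and passes to
  the sections \<open>A \<mapsto> V (insert t A)\<close>.\<close>

definition michael_open :: "nat set set \<Rightarrow> 'b topology \<Rightarrow> (nat set set \<Rightarrow> 'b set) \<Rightarrow> bool"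
  where "michael_open Z Y V \<longleftrightarrow> (\<forall>A y. finite A \<and> A \<subseteq> Z \<and> y \<in> V A \<longrightarrow>
    (\<exists>b W. openin Y W \<and> y \<in> W \<and>
      (\<forall>A'. finite A' \<and> A' \<subseteq> Z \<and>
        (\<forall>x'\<in>A'. x' \<in> A \<or> (\<exists>x\<in>A. finite x \<and> x' \<inter> {..<b} = x \<inter> {..<b})) \<longrightarrow> W \<subseteq> V A')))"

text \<open>Eventual membership along each row replaces the \<gamma>-cover property. Distinctness of
  the entries is not demanded, so the notion survives passing to sections.\<close>

definition gamma_array :: "nat set set \<Rightarrow> 'b topology \<Rightarrow> (nat \<Rightarrow> nat \<Rightarrow> nat set set \<Rightarrow> 'b set) \<Rightarrow> bool"
  where "gamma_array Z Y V \<longleftrightarrow> (\<forall>n m. michael_open Z Y (V n m)) \<and>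
    (\<forall>n A. finite A \<and> A \<subseteq> Z \<longrightarrow> (\<forall>y\<in>topspace Y. \<forall>\<^sub>F m in sequentially. y \<in> V n m A))"

lemma michael_openD:
  assumes "michael_open Z Y V" "finite A" "A \<subseteq> Z" "y \<in> V A"
  shows "\<exists>b W. openin Y W \<and> y \<in> W \<and>
      (\<forall>A'. finite A' \<and> A' \<subseteq> Z \<and>
        (\<forall>x'\<in>A'. x' \<in> A \<or> (\<exists>x\<in>A. finite x \<and> x' \<inter> {..<b} = x \<inter> {..<b})) \<longrightarrow> W \<subseteq> V A')"
  using assms(1)[unfolded michael_open_def, rule_format, of A y] assms(2-4) by simp

lemma gamma_array_reindex: "gamma_array Z Y V \<Longrightarrow> gamma_array Z Y (\<lambda>n. V (\<rho> n))"
  by (simp add: gamma_array_def)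

lemma michael_open_section:
  assumes V: "michael_open Z Y V" and t: "t \<in> Z"
  shows "michael_open Z Y (\<lambda>A. V (insert t A))"
  unfolding michael_open_def
proof (intro allI impI, elim conjE)
  fix A y assume A: "finite A" "A \<subseteq> Z" "y \<in> V (insert t A)"
  have "finite (insert t A)" "insert t A \<subseteq> Z"
    using A t by auto
  from michael_openD[OF V this A(3)] obtain b W where bW: "openin Y W \<and> y \<in> W \<and>
    (\<forall>A'. finite A' \<and> A' \<subseteq> Z \<and> (\<forall>x'\<in>A'. x' \<in> insert t A \<or>
      (\<exists>x\<in>insert t A. finite x \<and> x' \<inter> {..<b} = x \<inter> {..<b})) \<longrightarrow> W \<subseteq> V A')"
    by (elim exE) (rule that, assumption)
  have "W \<subseteq> V (insert t A')"
    if "finite A'" "A' \<subseteq> Z" "\<forall>x'\<in>A'. x' \<in> A \<or> (\<exists>x\<in>A. finite x \<and> x' \<inter> {..<b} = x \<inter> {..<b})" for A'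
    using that t by (intro bW[THEN conjunct2, THEN conjunct2, rule_format]) auto
  then show "\<exists>b W. openin Y W \<and> y \<in> W \<and>
      (\<forall>A'. finite A' \<and> A' \<subseteq> Z \<and>
        (\<forall>x'\<in>A'. x' \<in> A \<or> (\<exists>x\<in>A. finite x \<and> x' \<inter> {..<b} = x \<inter> {..<b})) \<longrightarrow> W \<subseteq> V (insert t A'))"
    using bW by (intro exI[of _ b] exI[of _ W]) simp
qed

lemma gamma_array_section:
  "gamma_array Z Y V \<Longrightarrow> t \<in> Z \<Longrightarrow> gamma_array Z Y (\<lambda>n m A. V n m (insert t A))"
  by (simp add: gamma_array_def michael_open_section)

text \<open>Take \<open>A' = A\<close> in the definition. This makes the entries at a fixed finite
  \<open>A\<close> Borel, as the hypothesis on \<open>Y\<close> requires.\<close>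

lemma openin_michael_open:
  assumes V: "michael_open Z Y V" and A: "finite A" "A \<subseteq> Z"
  shows "openin Y (V A)"
proof (subst openin_subopen, intro ballI)
  fix y assume y: "y \<in> V A"
  from michael_openD[OF V A y] obtain b W where bW: "openin Y W \<and> y \<in> W \<and>
    (\<forall>A'. finite A' \<and> A' \<subseteq> Z \<and> (\<forall>x'\<in>A'. x' \<in> A \<or>
      (\<exists>x\<in>A. finite x \<and> x' \<inter> {..<b} = x \<inter> {..<b})) \<longrightarrow> W \<subseteq> V A')"
    by (elim exE) (rule that, assumption)
  have "W \<subseteq> V A"
    using A by (intro bW[THEN conjunct2, THEN conjunct2, rule_format]) auto
  then show "\<exists>T. openin Y T \<and> y \<in> T \<and> T \<subseteq> V A"
    using bW by (intro exI[of _ W]) simp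
qed

section \<open>Selections\<close>

text \<open>The intervals \<open>[n, \<beta> n)\<close> for the indices \<open>n\<close> with \<open>\<phi> n \<le> g n\<close> work for all \<open>y\<close> at once up
  to finitely many \<open>n\<close>; the set \<open>d\<close> fed to \<open>fin_unbounded\<close> is so sparse that each of its
  intervals contains one of them.\<close>

lemma gamma_array_select_off_small:
  assumes S1: "S1 Borel_Gamma Borel_Gamma Y"
    and X: "fin_unbounded \<kappa> X"
    and V: "gamma_array (X \<union> Fin) Y V"
  shows "\<exists>\<phi>. \<forall>g. infinite {n. \<phi> n \<le> g n} \<longrightarrow>
    (\<exists>S\<subseteq>X. |S| <o \<kappa> \<and> (\<forall>A G. finite A \<and> A \<subseteq> X \<union> Fin \<and> A \<inter> S = {} \<and> finite G \<and> G \<subseteq> topspace Y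
      \<longrightarrow> (\<exists>n. G \<subseteq> V n (g n) A)))"
proof -
  interpret sigma_algebra "topspace Y" "borel_sets_of Y"
    by (rule sigma_algebra_borel_sets_of)
  have Vo: "michael_open (X \<union> Fin) Y (V n m)" for n m
    using V by (simp add: gamma_array_def)
  \<comment> \<open>\<open>Pow {..<n}\<close> is the test set of row \<open>n\<close>. Its members
    are exactly the possible traces below \<open>b \<ge> n\<close> of sets that omit the interval
    from \<open>n\<close> up to \<open>b\<close>.\<close>
  have P: "finite (Pow {..<n})" "Pow {..<n} \<subseteq> X \<union> Fin" for n :: nat
    by (auto intro: finite_subset[of _ "{..<n}"])
  have Vb: "V n m (Pow {..<n}) \<in> borel_sets_of Y" for n m
    using openin_michael_open[OF Vo P] by (rule borel_sets_of_openin)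
  have "\<forall>\<^sub>F m in sequentially. y \<in> V n m (Pow {..<n})" if "y \<in> topspace Y" for n y
    using V that P unfolding gamma_array_def by simp
  from S1_Borel_Gamma_eventually[OF S1 Vb this] obtain \<phi>
    where \<phi>: "\<forall>y\<in>topspace Y. \<forall>\<^sub>F n in sequentially. \<forall>m\<ge>\<phi> n. y \<in> V n m (Pow {..<n})" ..
  show ?thesis
  proof (intro exI[of _ \<phi>] allI impI)
    fix g assume J: "infinite {n. \<phi> n \<le> g n}"
    \<comment> \<open>The condition on \<open>x'\<close> says that \<open>x'\<close> omits the
      interval from \<open>n\<close> up to \<open>b\<close>; then it agrees below \<open>b\<close>
      with a member of \<open>Pow {..<n}\<close>. Hence each \<open>y\<close> in
      \<open>V n (g n) (Pow {..<n})\<close> enters \<open>W n b\<close> for large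
      \<open>b\<close>.\<close>
    define W where "W n b = \<Union>{w. openin Y w \<and> (\<forall>A'. finite A' \<and> A' \<subseteq> X \<union> Fin \<and>
      (\<forall>x'\<in>A'. x' \<inter> {..<b} \<subseteq> {..<n}) \<longrightarrow> w \<subseteq> V n (g n) A')}" for n b
    \<comment> \<open>The complement is added so that every \<open>y\<close> is eventually in row
      \<open>n\<close>. For large \<open>n\<close> with \<open>\<phi> n \<le> g n\<close> the choice
      of \<open>\<phi>\<close> rules the complement out, leaving
      \<open>y \<in> W n (\<beta> n)\<close>.\<close>
    define B where "B n b = (topspace Y - V n (g n) (Pow {..<n})) \<union> W n b" for n b
    have W_open: "openin Y (W n b)" for n b
      unfolding W_def by (rule openin_Union) auto
    have W_mono: "W n b \<subseteq> W n b'" if "b \<le> b'" for n b b'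
      unfolding W_def
    proof (intro Union_mono Collect_mono impI, elim conjE, intro conjI allI impI)
      fix w A' assume w: "\<forall>A'. finite A' \<and> A' \<subseteq> X \<union> Fin \<and>
          (\<forall>x'\<in>A'. x' \<inter> {..<b} \<subseteq> {..<n}) \<longrightarrow> w \<subseteq> V n (g n) A'"
        and A': "finite A' \<and> A' \<subseteq> X \<union> Fin \<and> (\<forall>x'\<in>A'. x' \<inter> {..<b'} \<subseteq> {..<n})"
      have "x' \<inter> {..<b} \<subseteq> {..<n}" if "x' \<in> A'" for x'
      proof -
        have "x' \<inter> {..<b} \<subseteq> x' \<inter> {..<b'}"
          using \<open>b \<le> b'\<close> by auto
        with A' that show ?thesis
          by blast
      qed
      then show "w \<subseteq> V n (g n) A'"
        using A' by (intro w[THEN spec, THEN mp]) simp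
    qed
    have W_ex: "\<exists>b. y \<in> W n b" if y: "y \<in> V n (g n) (Pow {..<n})" for n y
    proof -
      from michael_openD[OF Vo P y] obtain b w where bw: "openin Y w \<and> y \<in> w \<and>
        (\<forall>A'. finite A' \<and> A' \<subseteq> X \<union> Fin \<and> (\<forall>x'\<in>A'. x' \<in> Pow {..<n} \<or>
          (\<exists>x\<in>Pow {..<n}. finite x \<and> x' \<inter> {..<b} = x \<inter> {..<b})) \<longrightarrow> w \<subseteq> V n (g n) A')"
        by (elim exE) (rule that, assumption)
      have "w \<subseteq> V n (g n) A'" if "finite A'" "A' \<subseteq> X \<union> Fin" "\<forall>x'\<in>A'. x' \<inter> {..<b} \<subseteq> {..<n}" for A'
      proof (intro bw[THEN conjunct2, THEN conjunct2, rule_format] conjI that(1,2) ballI)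
        fix x' assume "x' \<in> A'"
        then have "x' \<inter> {..<b} \<in> Pow {..<n}" "finite (x' \<inter> {..<b})"
          "x' \<inter> {..<b} = (x' \<inter> {..<b}) \<inter> {..<b}"
          using that(3) by auto
        then show "x' \<in> Pow {..<n} \<or> (\<exists>x\<in>Pow {..<n}. finite x \<and> x' \<inter> {..<b} = x \<inter> {..<b})"
          by blast
      qed
      then have "w \<in> {w. openin Y w \<and> (\<forall>A'. finite A' \<and> A' \<subseteq> X \<union> Fin \<and>
          (\<forall>x'\<in>A'. x' \<inter> {..<b} \<subseteq> {..<n}) \<longrightarrow> w \<subseteq> V n (g n) A')}"
        using bw by simp
      then have "w \<subseteq> W n b"
        unfolding W_def by (rule Union_upper)
      then show ?thesis
        using bw by blast
    qed
    have "B n b \<in> borel_sets_of Y" for n b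
      unfolding B_def using Vb W_open borel_sets_of_openin by blast
    moreover have "\<forall>\<^sub>F b in sequentially. y \<in> B n b" if "y \<in> topspace Y" for n y
    proof (cases "y \<in> V n (g n) (Pow {..<n})")
      case True
      then show ?thesis
        using W_ex W_mono unfolding B_def eventually_sequentially by (meson UnI2 subsetD)
    qed (use that in \<open>simp add: B_def\<close>)
    ultimately obtain \<beta>
      where \<beta>: "\<forall>y\<in>topspace Y. \<forall>\<^sub>F n in sequentially. \<forall>b\<ge>\<beta> n. y \<in> B n b"
      using S1_Borel_Gamma_eventually[OF S1, of B] by blast
    have key: "\<forall>\<^sub>F n in sequentially. \<phi> n \<le> g n \<longrightarrow> y \<in> W n (\<beta> n)" if "y \<in> topspace Y" for y
      using \<phi>[rule_format, OF that] \<beta>[rule_format, OF that] by eventually_elim (auto simp: B_def)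
    have "\<exists>n\<ge>l. \<phi> n \<le> g n" for l
      using J by (simp add: infinite_nat_iff_unbounded_le)
    then obtain \<nu> where \<nu>: "\<And>l. \<nu> l \<ge> l" "\<And>l. \<phi> (\<nu> l) \<le> g (\<nu> l)"
      by metis
    \<comment> \<open>The interval from \<open>\<nu> (d i)\<close> up to
      \<open>\<beta> (\<nu> (d i))\<close> lies between \<open>d i\<close> and
      \<open>d (Suc i)\<close>, because \<open>\<nu> l \<ge> l\<close>; the term
      \<open>Suc l\<close> keeps \<open>d\<close> strictly increasing.\<close>
    define d where "d = rec_nat 0 (\<lambda>_ l. max (Suc l) (\<beta> (\<nu> l)))"
    have d_Suc: "d (Suc i) = max (Suc (d i)) (\<beta> (\<nu> (d i)))" for i
      by (simp add: d_def)
    have sm: "strict_mono d"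
      by (simp add: strict_mono_Suc_iff d_Suc less_max_iff_disj)
    have "range d \<in> Infs"
      using sm by (simp add: range_inj_infinite strict_mono_imp_inj_on)
    then obtain S where S: "S \<subseteq> X" "|S| <o \<kappa>"
      "\<And>F. finite F \<Longrightarrow> F \<subseteq> X - S \<Longrightarrow> infinite (omitted_intervals (\<Union>F) (range d))"
      using X unfolding fin_unbounded_def by meson
    have "\<exists>n. G \<subseteq> V n (g n) A"
      if A: "finite A" "A \<subseteq> X \<union> Fin" "A \<inter> S = {}" and G: "finite G" "G \<subseteq> topspace Y" for A G
    proof -
      have "\<forall>\<^sub>F n in sequentially. \<forall>y\<in>G. \<phi> n \<le> g n \<longrightarrow> y \<in> W n (\<beta> n)"
        using G key by (intro eventually_ball_finite) auto
      then obtain n1 where n1: "\<And>n y. n \<ge> n1 \<Longrightarrow> y \<in> G \<Longrightarrow> \<phi> n \<le> g n \<Longrightarrow> y \<in> W n (\<beta> n)"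
        unfolding eventually_sequentially by blast
      \<comment> \<open>The finite members of \<open>A\<close> lie below a common \<open>L\<close>,
        hence below \<open>n\<close> once \<open>i \<ge> L\<close>. Only the members in
        \<open>X - S\<close> have to omit an interval of \<open>range d\<close>.\<close>
      have "finite (\<Union>(A \<inter> Fin))"
        using A(1) by auto
      then obtain L where L: "\<And>j. j \<in> \<Union>(A \<inter> Fin) \<Longrightarrow> j < L"
        by (meson finite_nat_set_iff_bounded)
      have "infinite (omitted_intervals (\<Union>(A \<inter> X)) (range d))"
        using A by (intro S(3)) auto
      then obtain i where i: "i \<ge> max n1 L" "i \<in> omitted_intervals (\<Union>(A \<inter> X)) (range d)"
        by (meson infinite_nat_iff_unbounded_le)
      have om: "\<Union>(A \<inter> X) \<inter> {d i..<d (Suc i)} = {}"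
        using i(2) by (simp add: omitted_intervals_def enumerate_range_strict_mono[OF sm])
      define n where "n = \<nu> (d i)"
      have ndi: "n \<ge> d i" "d i \<ge> i"
        using \<nu>(1) strict_mono_imp_increasing[OF sm] by (auto simp: n_def)
      have \<beta>d: "\<beta> n \<le> d (Suc i)"
        by (simp add: d_Suc n_def)
      have "x \<inter> {..<\<beta> n} \<subseteq> {..<n}" if "x \<in> A" for x
      proof
        fix j assume j: "j \<in> x \<inter> {..<\<beta> n}"
        show "j \<in> {..<n}"
        proof (cases "finite x")
          case True
          then have "j < L"
            using j that by (intro L) auto
          then show ?thesis
            using i(1) ndi by simp
        next
          case False
          then have "j \<in> \<Union>(A \<inter> X)"
            using j that A(2) by auto
          then have "j \<notin> {d i..<d (Suc i)}"
            using om by blast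
          then show ?thesis
            using j \<beta>d ndi by auto
        qed
      qed
      then have "W n (\<beta> n) \<subseteq> V n (g n) A"
        using A(1,2) unfolding W_def by blast
      moreover have "G \<subseteq> W n (\<beta> n)"
        using n1[of n] i(1) ndi \<nu>(2)[of "d i"] by (auto simp: n_def)
      ultimately show ?thesis
        by blast
    qed
    then show "\<exists>S\<subseteq>X. |S| <o \<kappa> \<and> (\<forall>A G. finite A \<and> A \<subseteq> X \<union> Fin \<and> A \<inter> S = {} \<and> finite G \<and>
        G \<subseteq> topspace Y \<longrightarrow> (\<exists>n. G \<subseteq> V n (g n) A))"
      using S(1,2) by (intro exI[of _ S]) simp
  qed
qed

text \<open>Even rows deal with all \<open>A\<close> missing a small set \<open>S\<close> (common to all arrays of the family by
  regularity), odd rows with the family of all sections at the points of \<open>S\<close>.\<close>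

lemma small_family_select_card:
  fixes \<kappa> :: "'c rel" and Y :: "'b topology"
  assumes \<kappa>: "Card_order \<kappa>" "cinfinite \<kappa>" "regularCard \<kappa>" "\<kappa> \<le>o dominating_number"
    and X: "fin_unbounded \<kappa> X"
    and S1: "S1 Borel_Gamma Borel_Gamma Y"
    and T: "|T| <o \<kappa>" "\<forall>V\<in>T. gamma_array (X \<union> Fin) Y V"
  shows "\<exists>g. \<forall>V\<in>T. \<forall>A G. finite A \<and> A \<subseteq> X \<union> Fin \<and> card A \<le> j \<and> finite G \<and> G \<subseteq> topspace Y
      \<longrightarrow> (\<exists>n. G \<subseteq> V n (g n) A)"
  using T
proof (induction j arbitrary: T)
  let ?Z = "X \<union> Fin"
  \<comment> \<open>One \<open>g\<close> meets all thresholds \<open>\<phi> V\<close> infinitely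
    often since the family is smaller than \<open>dominating_number\<close>; the sets
    \<open>S V\<close> obtained for this \<open>g\<close> are then united.\<close>
  have XT: "\<exists>g S. S \<subseteq> X \<and> |S| <o \<kappa> \<and> (\<forall>V\<in>T. \<forall>A G. finite A \<and> A \<subseteq> ?Z \<and> A \<inter> S = {} \<and> finite G \<and>
      G \<subseteq> topspace Y \<longrightarrow> (\<exists>n. G \<subseteq> V n (g n) A))"
    if T: "|T| <o \<kappa>" "\<forall>V\<in>T. gamma_array ?Z Y V"
    for T :: "(nat \<Rightarrow> nat \<Rightarrow> nat set set \<Rightarrow> 'b set) set"
  proof -
    have "\<forall>V\<in>T. \<exists>\<phi>. \<forall>g. infinite {n. \<phi> n \<le> g n} \<longrightarrow>
      (\<exists>S\<subseteq>X. |S| <o \<kappa> \<and> (\<forall>A G. finite A \<and> A \<subseteq> ?Z \<and> A \<inter> S = {} \<and> finite G \<and> G \<subseteq> topspace Y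
        \<longrightarrow> (\<exists>n. G \<subseteq> V n (g n) A)))"
      using gamma_array_select_off_small[OF S1 X] T(2) by (intro ballI) blast
    from bchoice[OF this] obtain \<phi> where \<phi>: "\<forall>V\<in>T. \<forall>g. infinite {n. \<phi> V n \<le> g n} \<longrightarrow>
      (\<exists>S\<subseteq>X. |S| <o \<kappa> \<and> (\<forall>A G. finite A \<and> A \<subseteq> ?Z \<and> A \<inter> S = {} \<and> finite G \<and> G \<subseteq> topspace Y
        \<longrightarrow> (\<exists>n. G \<subseteq> V n (g n) A)))" ..
    have "|T| <o dominating_number"
      using T(1) \<kappa>(4) ordLess_ordLeq_trans by blast
    then obtain g where "\<And>V. V \<in> T \<Longrightarrow> infinite {n. \<phi> V n \<le> g n}"
      using small_family_not_dominating[of T \<phi>] by blast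
    then have "\<forall>V\<in>T. \<exists>S\<subseteq>X. |S| <o \<kappa> \<and> (\<forall>A G. finite A \<and> A \<subseteq> ?Z \<and> A \<inter> S = {} \<and> finite G \<and>
        G \<subseteq> topspace Y \<longrightarrow> (\<exists>n. G \<subseteq> V n (g n) A))"
      by (intro ballI \<phi>[rule_format])
    from bchoice[OF this] obtain S where S: "\<forall>V\<in>T. S V \<subseteq> X \<and> |S V| <o \<kappa> \<and>
        (\<forall>A G. finite A \<and> A \<subseteq> ?Z \<and> A \<inter> S V = {} \<and> finite G \<and> G \<subseteq> topspace Y \<longrightarrow>
          (\<exists>n. G \<subseteq> V n (g n) A))" ..
    have "|\<Union>V\<in>T. S V| <o \<kappa>"
      using \<kappa> T(1) S by (intro card_of_UNION_ordLess_infinite_Field_regularCard) auto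
    moreover have "(\<Union>V\<in>T. S V) \<subseteq> X"
      using S by blast
    moreover have "\<forall>V\<in>T. \<forall>A G. finite A \<and> A \<subseteq> ?Z \<and> A \<inter> (\<Union>V\<in>T. S V) = {} \<and> finite G \<and>
      G \<subseteq> topspace Y \<longrightarrow> (\<exists>n. G \<subseteq> V n (g n) A)"
    proof (intro ballI allI impI)
      fix V A G
      assume "V \<in> T" and *: "finite A \<and> A \<subseteq> ?Z \<and> A \<inter> (\<Union>V\<in>T. S V) = {} \<and> finite G \<and> G \<subseteq> topspace Y"
      then have "A \<inter> S V = {}"
        by blast
      then show "\<exists>n. G \<subseteq> V n (g n) A"
        using bspec[OF S \<open>V \<in> T\<close>] * by simp
    qed
    ultimately show ?thesis
      by blast
  qed
  {
    case 0
    from XT[OF 0] obtain g S where gS: "\<forall>V\<in>T. \<forall>A G. finite A \<and> A \<subseteq> ?Z \<and> A \<inter> S = {} \<and> finite G \<and>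
      G \<subseteq> topspace Y \<longrightarrow> (\<exists>n. G \<subseteq> V n (g n) A)"
      by (elim exE conjE) (rule that)
    \<comment> \<open>Only the empty \<open>A\<close> is left, and it is disjoint from
      \<open>S\<close>.\<close>
    show ?case
      by (rule exI[of _ g]) (use gS in auto)
  next
    case (Suc j)
    define T0 where "T0 = (\<lambda>V n. V (2 * n)) ` T"
    have T0: "|T0| <o \<kappa>" "\<forall>V\<in>T0. gamma_array ?Z Y V"
    proof -
      show "|T0| <o \<kappa>"
        unfolding T0_def using card_of_image Suc.prems(1) by (rule ordLeq_ordLess_trans)
      show "\<forall>V\<in>T0. gamma_array ?Z Y V"
      proof
        fix V assume "V \<in> T0"
        then obtain V' where "V' \<in> T" "V = (\<lambda>n. V' (2 * n))"
          by (auto simp: T0_def)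
        then show "gamma_array ?Z Y V"
          using gamma_array_reindex[OF bspec[OF Suc.prems(2)], of V' "\<lambda>n. 2 * n"] by simp
      qed
    qed
    from XT[OF T0] obtain g S where S: "S \<subseteq> X" "|S| <o \<kappa>"
      and gS: "\<forall>V\<in>T0. \<forall>A G. finite A \<and> A \<subseteq> ?Z \<and> A \<inter> S = {} \<and> finite G \<and>
        G \<subseteq> topspace Y \<longrightarrow> (\<exists>n. G \<subseteq> V n (g n) A)"
      by (elim exE conjE) (rule that)
    \<comment> \<open>A point \<open>t\<close> of \<open>S\<close> occurring in \<open>A\<close> is
      absorbed into the array, so the induction hypothesis only has to treat \<open>A - {t}\<close>,
      which has at most \<open>j\<close> elements.\<close>
    define sec where "sec V t = (\<lambda>n m A. V (2 * n + 1) m (insert t A))"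
      for V :: "nat \<Rightarrow> nat \<Rightarrow> nat set set \<Rightarrow> 'b set" and t
    define T1 where "T1 = (\<Union>V\<in>T. sec V ` S)"
    have "|sec V ` S| <o \<kappa>" for V
      using card_of_image S(2) by (rule ordLeq_ordLess_trans)
    then have T1: "|T1| <o \<kappa>"
      unfolding T1_def using \<kappa> Suc.prems(1)
      by (intro card_of_UNION_ordLess_infinite_Field_regularCard) auto
    have "\<forall>V\<in>T1. gamma_array ?Z Y V"
    proof
      fix V assume V: "V \<in> T1"
      obtain V' t where V': "V' \<in> T" "t \<in> S" "V = sec V' t"
        using V by (auto simp: T1_def)
      then have "gamma_array ?Z Y (\<lambda>n. V' (2 * n + 1))" "t \<in> ?Z"
        using gamma_array_reindex[OF bspec[OF Suc.prems(2)], of V' "\<lambda>n. 2 * n + 1"] S(1) by auto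
      then show "gamma_array ?Z Y V"
        unfolding V' sec_def by (rule gamma_array_section)
    qed
    from Suc.IH[OF T1 this] obtain h where h: "\<forall>V\<in>T1. \<forall>A G. finite A \<and> A \<subseteq> ?Z \<and> card A \<le> j \<and> finite G \<and>
        G \<subseteq> topspace Y \<longrightarrow> (\<exists>n. G \<subseteq> V n (h n) A)" ..
    define f where "f n = (if even n then g (n div 2) else h (n div 2))" for n
    show ?case
    proof (intro exI[of _ f] ballI allI impI, elim conjE)
      fix V A G assume V: "V \<in> T" and A: "finite A" "A \<subseteq> ?Z" "card A \<le> Suc j"
        and G: "finite G" "G \<subseteq> topspace Y"
      show "\<exists>n. G \<subseteq> V n (f n) A"
      proof (cases "A \<inter> S = {}")
        case True
        then obtain n where "G \<subseteq> V (2 * n) (g n) A"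
          using gS[THEN bspec, of "\<lambda>n. V (2 * n)", rule_format, of A G] V A G by (auto simp: T0_def)
        then have "G \<subseteq> V (2 * n) (f (2 * n)) A"
          by (simp add: f_def)
        then show ?thesis ..
      next
        case False
        then obtain t where t: "t \<in> A" "t \<in> S"
          by blast
        then have "sec V t \<in> T1" "card (A - {t}) \<le> j"
          using V A by (auto simp: T1_def)
        then obtain n where "G \<subseteq> sec V t n (h n) (A - {t})"
          using h[THEN bspec, of "sec V t", rule_format, of "A - {t}" G] A G by auto
        then have "G \<subseteq> V (2 * n + 1) (f (2 * n + 1)) A"
          using t by (simp add: f_def sec_def insert_absorb)
        then show ?thesis ..
      qed
    qed
  }
qed

text \<open>The selection for sets of at most \<open>j\<close> coordinates depends on
  \<open>j\<close>. Therefore \<open>prod_encode\<close> splits the rows into infinitely many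
  blocks, and block \<open>j\<close> is devoted to these sets.\<close>

lemma gamma_array_select:
  fixes \<kappa> :: "'c rel" and Y :: "'b topology"
  assumes \<kappa>: "Card_order \<kappa>" "cinfinite \<kappa>" "regularCard \<kappa>" "\<kappa> \<le>o dominating_number"
    and X: "fin_unbounded \<kappa> X"
    and S1: "S1 Borel_Gamma Borel_Gamma Y"
    and V: "gamma_array (X \<union> Fin) Y V"
  obtains g where "\<And>A G. finite A \<Longrightarrow> A \<subseteq> X \<union> Fin \<Longrightarrow> finite G \<Longrightarrow> G \<subseteq> topspace Y
    \<Longrightarrow> \<exists>n. G \<subseteq> V n (g n) A"
proof -
  \<comment> \<open>As \<open>\<kappa>\<close> is infinite, a single array is already a small
    family.\<close>
  have small: "|{W}| <o \<kappa>" for W :: "nat \<Rightarrow> nat \<Rightarrow> nat set set \<Rightarrow> 'b set"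
  proof -
    have "|{W}| <o |Field \<kappa>|"
      using \<kappa>(2) by (intro finite_ordLess_infinite card_of_Well_order) (simp_all add: cinfinite_def Field_card_of)
    then show ?thesis
      using card_of_Field_ordIso[OF \<kappa>(1)] ordLess_ordIso_trans by blast
  qed
  have "\<exists>g. \<forall>A G. finite A \<and> A \<subseteq> X \<union> Fin \<and> card A \<le> j \<and> finite G \<and> G \<subseteq> topspace Y
      \<longrightarrow> (\<exists>n. G \<subseteq> V (prod_encode (j, n)) (g n) A)" for j
    using small_family_select_card[OF \<kappa> X S1 small, of "\<lambda>n. V (prod_encode (j, n))" j]
      gamma_array_reindex[OF V] by simp
  then obtain g where g: "\<And>j A G. finite A \<and> A \<subseteq> X \<union> Fin \<and> card A \<le> j \<and> finite G \<and> G \<subseteq> topspace Y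
      \<Longrightarrow> \<exists>n. G \<subseteq> V (prod_encode (j, n)) (g j n) A"
    by metis
  show thesis
  proof (rule that[of "\<lambda>n. case prod_decode n of (j, i) \<Rightarrow> g j i"])
    fix A G assume "finite A" "A \<subseteq> X \<union> Fin" "finite G" "G \<subseteq> topspace Y"
    then obtain n where "G \<subseteq> V (prod_encode (card A, n)) (g (card A) n) A"
      using g[of A "card A" G] by blast
    then have "G \<subseteq> V (prod_encode (card A, n))
        (case prod_decode (prod_encode (card A, n)) of (j, i) \<Rightarrow> g j i) A"
      by simp
    then show "\<exists>n. G \<subseteq> V n (case prod_decode n of (j, i) \<Rightarrow> g j i) A" ..
  qed
qed

section \<open>The Michael topology on powers\<close>

text \<open>A basic box of the product restricts only finitely many coordinates, and
  \<open>b\<close> is any strict bound on them.\<close>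

lemma openin_cantor_space_nbhd:
  assumes "openin cantor_space V" "x \<in> V"
  obtains b where "\<And>x'. x' \<inter> {..<b} = x \<inter> {..<b} \<Longrightarrow> x' \<in> V"
proof -
  let ?f = "\<lambda>(x::nat set) n. n \<in> x"
  obtain U where U: "openin (product_topology (\<lambda>_. discrete_topology (UNIV :: bool set)) UNIV) U"
    "V = ?f -` U"
    using assms(1) unfolding cantor_space_def openin_pullback_topology by auto
  then have "?f x \<in> U"
    using assms(2) by simp
  with U(1)[unfolded openin_product_topology_alt, THEN bspec]
  have "\<exists>P. finite {i. P i \<noteq> (UNIV :: bool set)} \<and> ?f x \<in> Pi\<^sub>E UNIV P \<and> Pi\<^sub>E UNIV P \<subseteq> U"
    by simp
  then obtain P where P: "finite {i. P i \<noteq> (UNIV :: bool set)}" "?f x \<in> Pi\<^sub>E UNIV P" "Pi\<^sub>E UNIV P \<subseteq> U"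
    by blast
  obtain b where b: "\<And>i. P i \<noteq> UNIV \<Longrightarrow> i < b"
    using P(1) unfolding finite_nat_set_iff_bounded by blast
  show thesis
  proof
    fix x' assume x': "x' \<inter> {..<b} = x \<inter> {..<b}"
    have "?f x' i \<in> P i" for i
    proof (cases "P i = UNIV")
      case False
      then have "(i \<in> x') = (i \<in> x)"
        using b[OF False] x' by blast
      then show ?thesis
        using P(2) by (auto simp: PiE_def Pi_def)
    qed simp
    then show "x' \<in> V"
      using P(3) U(2) by (auto simp: PiE_def Pi_def)
  qed
qed

text \<open>Infinite coordinates of \<open>x\<close> are kept fixed. Each finite one has a Cantor
  neighbourhood within its factor of a basic box, and the largest of the \<open>k\<close> bounds
  serves all.\<close>

lemma openin_michael_power_nbhd:
  fixes k :: nat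
  assumes U: "openin (prod_topology (product_topology (\<lambda>_. subtopology michael_space Z) {..<k}) Y) U"
    and xy: "(x, y) \<in> U"
  shows "\<exists>b W. openin Y W \<and> y \<in> W \<and> (\<forall>x' y'. x' \<in> {..<k} \<rightarrow>\<^sub>E Z \<and> y' \<in> W \<and>
      (\<forall>i<k. x' i = x i \<or> finite (x i) \<and> x' i \<inter> {..<b} = x i \<inter> {..<b}) \<longrightarrow> (x', y') \<in> U)"
proof -
  obtain N W where N: "openin (product_topology (\<lambda>_. subtopology michael_space Z) {..<k}) N" "x \<in> N"
    and W: "openin Y W" "y \<in> W" and NW: "N \<times> W \<subseteq> U"
    using U xy unfolding openin_prod_topology_alt by meson
  obtain P where P: "\<And>i. i < k \<Longrightarrow> openin (subtopology michael_space Z) (P i)"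
    "x \<in> Pi\<^sub>E {..<k} P" "Pi\<^sub>E {..<k} P \<subseteq> N"
    using N unfolding openin_product_topology_alt by (metis lessThan_iff)
  have "\<exists>b. \<forall>x'\<in>Z. finite (x i) \<and> x' \<inter> {..<b} = x i \<inter> {..<b} \<longrightarrow> x' \<in> P i" if i: "i < k" for i
  proof (cases "finite (x i)")
    case True
    obtain M where M: "openin michael_space M" "P i = M \<inter> Z"
      using P(1)[OF i] unfolding openin_subtopology by blast
    have "x i \<in> M \<inter> Fin"
      using P(2) i M(2) True by (auto simp: PiE_def Pi_def)
    then obtain V where V: "openin cantor_space V" "x i \<in> V" "V \<subseteq> M"
      using M(1) unfolding openin_michael_space by blast
    obtain b where "\<And>x'. x' \<inter> {..<b} = x i \<inter> {..<b} \<Longrightarrow> x' \<in> V"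
      using openin_cantor_space_nbhd[OF V(1,2)] by blast
    then show ?thesis
      using V(3) M(2) by blast
  qed simp
  then obtain b where b: "\<And>i x'. i < k \<Longrightarrow> x' \<in> Z \<Longrightarrow> finite (x i) \<Longrightarrow>
      x' \<inter> {..<b i} = x i \<inter> {..<b i} \<Longrightarrow> x' \<in> P i"
    by metis
  \<comment> \<open>The inserted \<open>0\<close> keeps the set nonempty when
    \<open>k = 0\<close>.\<close>
  define c where "c = Max (insert 0 (b ` {..<k}))"
  have c: "b i \<le> c" if "i < k" for i
    unfolding c_def using that by (intro Max_ge) auto
  show ?thesis
  proof (intro exI[of _ c] exI[of _ W] conjI W allI impI, elim conjE)
    fix x' y' assume x': "x' \<in> {..<k} \<rightarrow>\<^sub>E Z" and y': "y' \<in> W"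
      and eq: "\<forall>i<k. x' i = x i \<or> finite (x i) \<and> x' i \<inter> {..<c} = x i \<inter> {..<c}"
    have "x' i \<in> P i" if i: "i < k" for i
    proof (cases "x' i = x i")
      case True
      then show ?thesis
        using P(2) i by (auto simp: PiE_def Pi_def)
    next
      case False
      then have fin: "finite (x i)" and e: "x' i \<inter> {..<c} = x i \<inter> {..<c}"
        using eq i by auto
      have "z \<inter> {..<b i} = (z \<inter> {..<c}) \<inter> {..<b i}" for z
        using c[OF i] by auto
      then have "x' i \<inter> {..<b i} = x i \<inter> {..<b i}"
        using e by metis
      then show ?thesis
        using b[OF i _ fin] x' i by (auto simp: PiE_def Pi_def)
    qed
    then have "x' \<in> Pi\<^sub>E {..<k} P"
      using x' by (auto simp: PiE_def Pi_def)
    then show "(x', y') \<in> U"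
      using P(3) NW y' by blast
  qed
qed

text \<open>Over a finite \<open>A\<close> there are finitely many tuples, so their bounds and
  neighbourhoods can be merged. A tuple over \<open>A'\<close> is compared with the tuple over
  \<open>A\<close> obtained by replacing each coordinate by a point of \<open>A\<close> that it
  equals or agrees with below \<open>c\<close>.\<close>

lemma michael_open_power:
  fixes k :: nat
  assumes U: "openin (prod_topology (product_topology (\<lambda>_. subtopology michael_space Z) {..<k}) Y) U"
  shows "michael_open Z Y (\<lambda>A. {y \<in> topspace Y. \<forall>x\<in>{..<k} \<rightarrow>\<^sub>E A. (x, y) \<in> U})"
  unfolding michael_open_def
proof (intro allI impI, elim conjE)
  fix A y assume A: "finite A" "A \<subseteq> Z" and "y \<in> {y \<in> topspace Y. \<forall>x\<in>{..<k} \<rightarrow>\<^sub>E A. (x, y) \<in> U}"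
  then have y: "y \<in> topspace Y" "\<And>x. x \<in> {..<k} \<rightarrow>\<^sub>E A \<Longrightarrow> (x, y) \<in> U"
    by auto
  let ?E = "{..<k} \<rightarrow>\<^sub>E A"
  have "\<forall>x\<in>?E. \<exists>b W. openin Y W \<and> y \<in> W \<and> (\<forall>x' y'. x' \<in> {..<k} \<rightarrow>\<^sub>E Z \<and> y' \<in> W \<and>
      (\<forall>i<k. x' i = x i \<or> finite (x i) \<and> x' i \<inter> {..<b} = x i \<inter> {..<b}) \<longrightarrow> (x', y') \<in> U)"
  proof
    fix x assume "x \<in> ?E"
    from openin_michael_power_nbhd[OF U y(2)[OF this]]
    show "\<exists>b W. openin Y W \<and> y \<in> W \<and> (\<forall>x' y'. x' \<in> {..<k} \<rightarrow>\<^sub>E Z \<and> y' \<in> W \<and>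
      (\<forall>i<k. x' i = x i \<or> finite (x i) \<and> x' i \<inter> {..<b} = x i \<inter> {..<b}) \<longrightarrow> (x', y') \<in> U)" .
  qed
  from bchoice[OF this] obtain b where "\<forall>x\<in>?E. \<exists>W. openin Y W \<and> y \<in> W \<and>
      (\<forall>x' y'. x' \<in> {..<k} \<rightarrow>\<^sub>E Z \<and> y' \<in> W \<and>
        (\<forall>i<k. x' i = x i \<or> finite (x i) \<and> x' i \<inter> {..<b x} = x i \<inter> {..<b x}) \<longrightarrow> (x', y') \<in> U)" ..
  from bchoice[OF this] obtain W where bW: "\<forall>x\<in>?E. openin Y (W x) \<and> y \<in> W x \<and>
      (\<forall>x' y'. x' \<in> {..<k} \<rightarrow>\<^sub>E Z \<and> y' \<in> W x \<and>
        (\<forall>i<k. x' i = x i \<or> finite (x i) \<and> x' i \<inter> {..<b x} = x i \<inter> {..<b x}) \<longrightarrow> (x', y') \<in> U)" ..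
  have finE: "finite ?E"
    using A(1) by (intro finite_PiE) auto
  define c where "c = Max (insert 0 (b ` ?E))"
  have c: "b x \<le> c" if "x \<in> ?E" for x
    unfolding c_def using that finE by (intro Max_ge) auto
  \<comment> \<open>For empty \<open>A\<close> and positive \<open>k\<close> there are no tuples and
    the intersection is \<open>UNIV\<close>; intersecting with \<open>topspace Y\<close> keeps the
    set open.\<close>
  define O' where "O' = topspace Y \<inter> \<Inter>(W ` ?E)"
  have "openin Y O'"
  proof (cases "?E = {}")
    case False
    then have "openin Y (\<Inter>(W ` ?E))"
      using finE bW by (intro openin_INT2) auto
    then show ?thesis
      unfolding O'_def by (intro openin_Int) auto
  qed (auto simp: O'_def)
  moreover have "y \<in> O'"
    using y(1) bW by (simp add: O'_def)
  moreover have "O' \<subseteq> {y \<in> topspace Y. \<forall>x\<in>{..<k} \<rightarrow>\<^sub>E A'. (x, y) \<in> U}"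
    if A': "A' \<subseteq> Z" "\<forall>x'\<in>A'. x' \<in> A \<or> (\<exists>x\<in>A. finite x \<and> x' \<inter> {..<c} = x \<inter> {..<c})" for A'
  proof (intro subsetI CollectI conjI ballI)
    fix y' x' assume y': "y' \<in> O'" and x': "x' \<in> {..<k} \<rightarrow>\<^sub>E A'"
    have "\<forall>i\<in>{..<k}. \<exists>z. z \<in> A \<and> (x' i = z \<or> finite z \<and> x' i \<inter> {..<c} = z \<inter> {..<c})"
    proof
      fix i assume "i \<in> {..<k}"
      then have "x' i \<in> A'"
        using x' by (rule PiE_mem[rotated])
      then show "\<exists>z. z \<in> A \<and> (x' i = z \<or> finite z \<and> x' i \<inter> {..<c} = z \<inter> {..<c})"
        using A'(2) by blast
    qed
    from bchoice[OF this] obtain z where z: "\<forall>i\<in>{..<k}. z i \<in> A \<and>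
      (x' i = z i \<or> finite (z i) \<and> x' i \<inter> {..<c} = z i \<inter> {..<c})" ..
    define x where "x = restrict z {..<k}"
    have x: "x \<in> ?E"
      using z by (simp add: x_def PiE_def Pi_def)
    have sub: "s \<inter> {..<b x} = (s \<inter> {..<c}) \<inter> {..<b x}" for s
      using c[OF x] by auto
    have "\<forall>i<k. x' i = x i \<or> finite (x i) \<and> x' i \<inter> {..<b x} = x i \<inter> {..<b x}"
    proof (intro allI impI)
      fix i assume "i < k"
      then show "x' i = x i \<or> finite (x i) \<and> x' i \<inter> {..<b x} = x i \<inter> {..<b x}"
        using z sub[of "x' i"] sub[of "x i"] by (auto simp: x_def)
    qed
    moreover have "x' \<in> {..<k} \<rightarrow>\<^sub>E Z"
      using x' A'(1) by (auto simp: PiE_def Pi_def)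
    moreover have "y' \<in> W x"
      using y' x by (auto simp: O'_def)
    ultimately show "(x', y') \<in> U"
      using bspec[OF bW x] by simp
  qed (auto simp: O'_def)
  ultimately show "\<exists>b W. openin Y W \<and> y \<in> W \<and>
      (\<forall>A'. finite A' \<and> A' \<subseteq> Z \<and>
        (\<forall>x'\<in>A'. x' \<in> A \<or> (\<exists>x\<in>A. finite x \<and> x' \<inter> {..<b} = x \<inter> {..<b})) \<longrightarrow>
          W \<subseteq> {y \<in> topspace Y. \<forall>x\<in>{..<k} \<rightarrow>\<^sub>E A'. (x, y) \<in> U})"
    by meson
qed

section \<open>Comparison of the Michael and Cantor topologies, and the selection principle\<close>

lemma openin_michael_space_if_cantor_space: "openin cantor_space U \<Longrightarrow> openin michael_space U"
  unfolding openin_michael_space by blast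

text \<open>The Michael topology is finer, so the identity is continuous on each factor and hence on
  the product with \<open>Y\<close>; \<open>U\<close> is a preimage under it.\<close>

lemma openin_michael_power_if_cantor:
  fixes k :: nat
  assumes "openin (subtopology (prod_topology (product_topology (\<lambda>_. cantor_space) {..<k}) Y)
            (({..<k} \<rightarrow>\<^sub>E Z) \<times> topspace Y)) U"
  shows "openin (prod_topology (product_topology (\<lambda>_. subtopology michael_space Z) {..<k}) Y) U"
proof -
  let ?M = "product_topology (\<lambda>_. subtopology michael_space Z) {..<k}"
  let ?C = "product_topology (\<lambda>_. cantor_space) {..<k}"
  obtain U' where U': "openin (prod_topology ?C Y) U'" "U = U' \<inter> (({..<k} \<rightarrow>\<^sub>E Z) \<times> topspace Y)"
    using assms unfolding openin_subtopology by blast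
  have "continuous_map (subtopology michael_space Z) cantor_space id"
    by (rule continuous_map_from_subtopology)
      (auto simp: continuous_map_def openin_michael_space_if_cantor_space)
  then have proj: "continuous_map ?M cantor_space (\<lambda>x. x i)" if "i < k" for i
    using continuous_map_compose[OF continuous_map_product_projection[of i "{..<k}"]] that
    by (fastforce simp: o_def)
  have "continuous_map ?M ?C id"
    unfolding continuous_map_componentwise using proj by (auto simp: PiE_def)
  then have "continuous_map (prod_topology ?M Y) (prod_topology ?C Y) (\<lambda>(x, y). (id x, id y))"
    by (intro continuous_map_prod_top[THEN iffD2] disjI2 conjI) (auto simp: id_def)
  then have "openin (prod_topology ?M Y)
      {p \<in> topspace (prod_topology ?M Y). (\<lambda>(x, y). (id x, id y)) p \<in> U'}"
    using U'(1) by (rule openin_continuous_map_preimage)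
  also have "{p \<in> topspace (prod_topology ?M Y). (\<lambda>(x, y). (id x, id y)) p \<in> U'} = U"
    by (auto simp: U'(2))
  finally show ?thesis .
qed

text \<open>Open \<gamma>-covers of the coarser space are also open \<gamma>-covers of the finer
  one. The selected sets come from the given covers, so they are open in the coarser
  topology.\<close>

lemma S1_Open_Gamma_Open_Omega_coarser:
  assumes "topspace Z' = topspace Z" and "\<And>U. openin Z' U \<Longrightarrow> openin Z U"
    and "S1 Open_Gamma Open_Omega Z"
  shows "S1 Open_Gamma Open_Omega Z'"
  unfolding S1_def
proof (intro allI impI)
  fix \<U> :: "nat \<Rightarrow> 'a set set"
  assume \<U>: "\<forall>n. \<U> n \<in> Open_Gamma Z'"
  then have "\<forall>n. \<U> n \<in> Open_Gamma Z"
    using assms(1,2) by (auto simp: Open_Gamma_def gamma_cover_def cover_of_def)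
  then obtain U where U: "\<forall>n. U n \<in> \<U> n" "range U \<in> Open_Omega Z"
    using assms(3) unfolding S1_def by blast
  have "openin Z' (U n)" for n
    using \<U> U(1) by (auto simp: Open_Gamma_def)
  then have "range U \<in> Open_Omega Z'"
    using U(2) assms(1) by (auto simp: Open_Omega_def omega_cover_def cover_of_def)
  with U(1) show "\<exists>U. (\<forall>n. U n \<in> \<U> n) \<and> range U \<in> Open_Omega Z'"
    by blast
qed

lemma S1_Open_Gamma_Open_Omega_michael_power:
  fixes \<kappa> :: "'c rel" and Y :: "'b topology" and k :: nat
  assumes \<kappa>: "Card_order \<kappa>" "cinfinite \<kappa>" "regularCard \<kappa>" "\<kappa> \<le>o dominating_number"
    and X: "fin_unbounded \<kappa> X"
    and S1: "S1 Borel_Gamma Borel_Gamma Y"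
  shows "S1 Open_Gamma Open_Omega
    (prod_topology (product_topology (\<lambda>_. subtopology michael_space (X \<union> Fin)) {..<k}) Y)"
    (is "S1 _ _ ?Z")
  unfolding S1_def
proof (intro allI impI)
  fix \<U> :: "nat \<Rightarrow> ((nat \<Rightarrow> nat set) \<times> 'b) set set"
  assume \<U>: "\<forall>n. \<U> n \<in> Open_Gamma ?Z"
  have top: "topspace ?Z = ({..<k} \<rightarrow>\<^sub>E X \<union> Fin) \<times> topspace Y"
    by simp
  \<comment> \<open>An infinite subfamily keeps the \<gamma>-property. The whole space is discarded
    because an \<omega>-cover must not contain it.\<close>
  have "\<exists>f :: nat \<Rightarrow> _. inj f \<and> range f \<subseteq> \<U> n - {topspace ?Z}" for n
    using \<U> by (intro infinite_countable_subset) (simp add: Open_Gamma_def gamma_cover_def)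
  then obtain u :: "nat \<Rightarrow> nat \<Rightarrow> _" where u: "\<And>n. inj (u n)" "\<And>n. range (u n) \<subseteq> \<U> n - {topspace ?Z}"
    by metis
  have u_in: "u n m \<in> \<U> n" "u n m \<noteq> topspace ?Z" for n m
    using u(2)[of n] by blast+
  have u_open: "openin ?Z (u n m)" for n m
    using \<U> u_in(1)[of n m] unfolding Open_Gamma_def by blast
  have u_ev: "\<forall>\<^sub>F m in sequentially. p \<in> u n m" if "p \<in> topspace ?Z" for n p
  proof -
    have "finite {U \<in> \<U> n. p \<notin> U}"
      using \<U> that unfolding Open_Gamma_def gamma_cover_def by blast
    \<comment> \<open>Injectivity of \<open>u n\<close> turns finitely many bad members into
      finitely many bad indices.\<close>
    then have "finite (u n ` {m. p \<notin> u n m})"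
      by (rule rev_finite_subset) (use u_in in auto)
    then have "finite {m. p \<notin> u n m}"
      using u(1) by (metis finite_imageD inj_on_subset subset_UNIV)
    then show ?thesis
      by (simp add: cofinite_eq_sequentially[symmetric] eventually_cofinite)
  qed
  define V where "V n m A = {y \<in> topspace Y. \<forall>x\<in>{..<k} \<rightarrow>\<^sub>E A. (x, y) \<in> u n m}" for n m A
  have "gamma_array (X \<union> Fin) Y V"
    unfolding gamma_array_def
  proof (intro conjI allI impI ballI)
    show "michael_open (X \<union> Fin) Y (V n m)" for n m
      unfolding V_def using u_open by (rule michael_open_power)
  next
    fix n A y assume A: "finite A \<and> A \<subseteq> X \<union> Fin" and y: "y \<in> topspace Y"
    have "\<forall>\<^sub>F m in sequentially. (x, y) \<in> u n m" if "x \<in> {..<k} \<rightarrow>\<^sub>E A" for x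
    proof (rule u_ev)
      show "(x, y) \<in> topspace ?Z"
        unfolding top using that A y PiE_mono[of "{..<k}" "\<lambda>_. A" "\<lambda>_. X \<union> Fin"] by blast
    qed
    then have "\<forall>\<^sub>F m in sequentially. \<forall>x\<in>{..<k} \<rightarrow>\<^sub>E A. (x, y) \<in> u n m"
      using A by (intro eventually_ball_finite finite_PiE) auto
    then show "\<forall>\<^sub>F m in sequentially. y \<in> V n m A"
      using y by (simp add: V_def)
  qed
  then obtain g where g: "\<And>A G. finite A \<Longrightarrow> A \<subseteq> X \<union> Fin \<Longrightarrow> finite G \<Longrightarrow> G \<subseteq> topspace Y
    \<Longrightarrow> \<exists>n. G \<subseteq> V n (g n) A"
    using gamma_array_select[OF \<kappa> X S1] by blast
  define U where "U n = u n (g n)" for n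
  have omega: "\<exists>n. F \<subseteq> U n" if F: "finite F" "F \<subseteq> topspace ?Z" for F
  proof -
    \<comment> \<open>Collecting all coordinates of all points of \<open>F\<close> makes every
      \<open>fst p\<close> a tuple over the one finite set \<open>A\<close>.\<close>
    define A where "A = (\<Union>p\<in>F. fst p ` {..<k})"
    have F_mem: "fst p \<in> {..<k} \<rightarrow>\<^sub>E X \<union> Fin \<and> snd p \<in> topspace Y" if "p \<in> F" for p
      using subsetD[OF F(2) that] unfolding top mem_Times_iff .
    have "A \<subseteq> X \<union> Fin"
      unfolding A_def using F_mem PiE_mem by fast
    moreover have "finite A" "finite (snd ` F)" "snd ` F \<subseteq> topspace Y"
      using F(1) F_mem by (auto simp: A_def)
    ultimately obtain n where n: "snd ` F \<subseteq> V n (g n) A"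
      using g by meson
    have "p \<in> U n" if "p \<in> F" for p
    proof -
      have "fst p \<in> {..<k} \<rightarrow>\<^sub>E A"
        using F_mem[OF that] that by (auto simp: A_def PiE_def)
      moreover have "snd p \<in> V n (g n) A"
        using n that by blast
      ultimately show ?thesis
        by (auto simp: V_def U_def)
    qed
    then show ?thesis
      by blast
  qed
  have "topspace ?Z \<subseteq> \<Union>(range U)"
    using omega[of "{p}" for p] by fastforce
  moreover have "\<Union>(range U) \<subseteq> topspace ?Z"
    using u_open openin_subset unfolding U_def by blast
  ultimately have "\<Union>(range U) = topspace ?Z"
    by (intro equalityI)
  moreover have "topspace ?Z \<notin> range U"
    using u_in(2) unfolding U_def by blast
  moreover have "\<forall>F. finite F \<and> F \<subseteq> topspace ?Z \<longrightarrow> (\<exists>W\<in>range U. F \<subseteq> W)"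
  proof (intro allI impI)
    fix F assume "finite F \<and> F \<subseteq> topspace ?Z"
    then obtain n where "F \<subseteq> U n"
      using omega[of F] by blast
    then show "\<exists>W\<in>range U. F \<subseteq> W"
      by (rule bexI[OF _ rangeI])
  qed
  moreover have "\<forall>W\<in>range U. openin ?Z W"
    using u_open unfolding U_def by blast
  ultimately have "range U \<in> Open_Omega ?Z"
    unfolding Open_Omega_def omega_cover_def cover_of_def by simp
  then show "\<exists>U. (\<forall>n. U n \<in> \<U> n) \<and> range U \<in> Open_Omega ?Z"
    using u_in(1) by (intro exI[of _ U]) (simp add: U_def)
qed

theorem theorem2p2:
  fixes \<kappa> :: "'c rel" and X :: "nat set set" and k :: nat and Y :: "'b topology"
  assumes "Card_order \<kappa>" and "cinfinite \<kappa>" and "regularCard \<kappa>"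
    and "\<kappa> \<le>o dominating_number"
    and "fin_unbounded \<kappa> X"
    and "set_of_reals Y" and "infinite (topspace Y)"
    and "S1 Borel_Gamma Borel_Gamma Y"
  shows "S1 Open_Gamma Open_Omega
          (prod_topology (product_topology (\<lambda>_. subtopology michael_space (X \<union> Fin)) {..<k}) Y) \<and>
        S1 Open_Gamma Open_Omega
          (subtopology (prod_topology (product_topology (\<lambda>_. cantor_space) {..<k}) Y)
            (({..<k} \<rightarrow>\<^sub>E X \<union> Fin) \<times> topspace Y))"
proof
  show michael: "S1 Open_Gamma Open_Omega
      (prod_topology (product_topology (\<lambda>_. subtopology michael_space (X \<union> Fin)) {..<k}) Y)"
    using assms(1-5,8) by (rule S1_Open_Gamma_Open_Omega_michael_power)
  \<comment> \<open>The Cantor power has the same points and no further open sets, so the principle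
    is inherited from the Michael power.\<close>
  show "S1 Open_Gamma Open_Omega
      (subtopology (prod_topology (product_topology (\<lambda>_. cantor_space) {..<k}) Y)
        (({..<k} \<rightarrow>\<^sub>E X \<union> Fin) \<times> topspace Y))"
    by (rule S1_Open_Gamma_Open_Omega_coarser[OF _ openin_michael_power_if_cantor michael])
      (auto simp: PiE_def)
qed

end
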